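(* For every $x\in(0,1/2]$, the Ramanujan constant function $R$ has the series expansion $$R(x)=\frac{1}{x}+\sum_{k=1}^{\infty}2\zeta(2k+1)x^{2k}.$$
   Context: The Ramanujan constant function is $R(x)=-2\gamma-\Psi(x)-\Psi(1-x)$ for $x\in(0,1/2]$, where $\gamma=\lim_{n\to\infty}\left(\sum_{k=1}^n 1/k-\log n\right)$ is the Euler-Mascheroni constant and $\Psi(x)=\Gamma'(x)/\Gamma(x)$ is the digamma function. Here $\zeta(x)=\sum_{n=1}^{\infty}n^{-x}$ is the Riemann zeta function. *)

theory Defs
  imports "HOL-Analysis.Analysis"
begin

text \<open>The Dirichlet series; it agrees with the Riemann zeta function only for \<open>s > 1\<close>, where it
  converges (see \<open>riemann_zeta_sums\<close>).\<close>
definition riemann_zeta :: "real \<Rightarrow> real" where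
  "riemann_zeta s = (\<Sum>n. real (Suc n) powr (- s))"

definition ramanujan_R :: "real \<Rightarrow> real" where
  "ramanujan_R x = - 2 * euler_mascheroni - Digamma x - Digamma (1 - x)"

text \<open>The library defines \<open>Digamma\<close> by a series.\<close>
lemma Digamma_eq_Gamma_quotient:
  fixes x :: real
  assumes "x > 0"
  shows "Digamma x = deriv Gamma x / Gamma x"
proof -
  have "x \<notin> \<int>\<^sub>\<le>\<^sub>0"
    using assms by (auto elim!: nonpos_Ints_cases)
  then have "deriv Gamma x = Gamma x * Digamma x"
    by (intro DERIV_imp_deriv has_field_derivative_Gamma)
  then show ?thesis
    using Gamma_real_pos[OF assms] by simp
qed

lemma riemann_zeta_sums:
  assumes "s > 1"
  shows "(\<lambda>n. real (Suc n) powr (- s)) sums riemann_zeta s"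
proof -
  have "summable (\<lambda>n. real n powr (- s))"
    using assms by (simp add: summable_real_powr_iff)
  then have "summable (\<lambda>n. real (Suc n) powr (- s))"
    by (subst summable_Suc_iff)
  then show ?thesis
    unfolding riemann_zeta_def by (rule summable_sums)
qed

end

(* Shifting Psi(x) to Psi(x+1) produces the term 1/x, and the series of the digamma function then give
   R(x) - 1/x = sum over m >= 1 of 1/(m - x) + 1/(m + x) - 2/m. The m-th term is the sum of the geometric
   series 2 x^(2k) / m^(2k+1) over k >= 1; all these summands are nonnegative, so the order of
   summation may be exchanged. *)
theory Submission
  imports Defs
begin

text \<open>For nonnegative terms \<open>sums\<close> upgrades to the unconditional
  \<open>has_sum\<close>, and the double sum over the product of the index sets can then be read by
  rows or by columns.\<close>

lemma sums_swap_nonneg: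
  fixes f :: "nat \<Rightarrow> nat \<Rightarrow> real"
  assumes nonneg: "\<And>m n. 0 \<le> f m n"
    and rows: "\<And>m. f m sums g m"
    and cols: "\<And>n. (\<lambda>m. f m n) sums h n"
    and total: "g sums S"
  shows "h sums S"
proof -
  have has_sumI: "(u has_sum s) UNIV" if "\<And>n. 0 \<le> u n" "u sums s" for u :: "nat \<Rightarrow> real" and s
    using that by (intro norm_summable_imp_has_sum) (auto simp: sums_iff)
  have g: "(g has_sum S) UNIV"
    by (rule has_sumI[OF _ total]) (rule sums_le[OF nonneg sums_zero rows])
  have f: "((\<lambda>n. f m n) has_sum g m) UNIV" for m
    by (rule has_sumI[OF nonneg rows])
  \<comment> \<open>As the entries are nonnegative, convergence of the row sums \<open>g\<close>
    already makes the whole double family summable.\<close>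
  have "(\<lambda>(m, n). f m n) summable_on UNIV \<times> UNIV"
    by (rule summable_on_SigmaI[where g = g]) (simp_all add: f nonneg has_sum_imp_summable[OF g])
  then have "((\<lambda>(m, n). f m n) has_sum S) (UNIV \<times> UNIV)"
    by (intro has_sum_SigmaI[OF _ g]) (simp_all add: f)
  from has_sum_swap[THEN iffD1, OF this]
  have swapped: "((\<lambda>(n, m). f m n) has_sum S) (UNIV \<times> UNIV)"
    by (simp only: prod.case)
  have "((\<lambda>m. f m n) has_sum h n) UNIV" for n
    by (rule has_sumI[OF nonneg cols])
  then have "(h has_sum S) UNIV"
    by (intro has_sum_SigmaD[OF swapped]) simp
  then show ?thesis
    by (rule has_sum_imp_sums)
qed

text \<open>This is the defining series of \<open>Digamma\<close> at \<open>1 + x\<close>, with the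
  constant moved to the other side and the shift by one absorbed into \<open>Suc n\<close>.\<close>

lemma Digamma_plus1_sums:
  fixes x :: real
  assumes "- 1 < x"
  shows "(\<lambda>n. 1 / real (Suc n) - 1 / (real (Suc n) + x)) sums (Digamma (1 + x) + euler_mascheroni)"
proof -
  have "1 + x \<noteq> 0"
    using assms by simp
  then have "(\<lambda>n. inverse (real (Suc n)) - inverse (1 + x + real n)) sums (Digamma (1 + x) + euler_mascheroni)"
    unfolding Digamma_def diff_add_cancel
    by (intro summable_sums summable_Digamma)
  moreover have "inverse (1 + x + real n) = 1 / (real (Suc n) + x)" for n
    by (simp add: inverse_eq_divide add_ac)
  ultimately show ?thesis
    by (simp only: inverse_eq_divide)
qed

text \<open>Geometric series with ratio \<open>(x / m)\<^sup>2\<close>; its value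
  \<open>2 * x\<^sup>2 / (m * (m\<^sup>2 - x\<^sup>2))\<close> is then split into partial
  fractions.\<close>

lemma sums_even_powers:
  fixes x m :: real
  assumes "\<bar>x\<bar> < m"
  shows "(\<lambda>k. 2 * x ^ (2 * Suc k) / m ^ (2 * Suc k + 1)) sums (1 / (m - x) + 1 / (m + x) - 2 / m)"
proof -
  have m: "m > 0" "m - x > 0" "m + x > 0"
    using assms by auto
  define q where "q = (x / m)\<^sup>2"
  have "\<bar>x / m\<bar> < 1"
    using assms m by simp
  then have "norm q < 1"
    unfolding q_def by (simp add: abs_square_less_1)
  \<comment> \<open>The extra factor \<open>q\<close> makes the series start at the first power
    instead of the constant term.\<close>
  from sums_mult[OF geometric_sums[OF this], of "2 / m * q"]
  have "(\<lambda>k. 2 / m * q ^ Suc k) sums (2 / m * q * (1 / (1 - q)))"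
    by (simp add: mult_ac)
  also have "2 / m * q * (1 / (1 - q)) = 1 / (m - x) + 1 / (m + x) - 2 / m"
  proof -
    have "1 - q = (m - x) * (m + x) / m\<^sup>2"
      using m by (simp add: q_def power_divide field_simps power2_eq_square)
    then show ?thesis
      using m unfolding q_def by (simp add: power_divide divide_simps) (simp add: algebra_simps power2_eq_square)
  qed
  also have "(\<lambda>k. 2 / m * q ^ Suc k) = (\<lambda>k. 2 * x ^ (2 * Suc k) / m ^ (2 * Suc k + 1))"
    by (simp only: q_def power_divide flip: power_mult) simp
  finally show ?thesis .
qed

text \<open>In the double family, rows (index \<open>n\<close>) sum to partial fractions and columns
  (index \<open>k\<close>) to zeta values. The bound on \<open>x\<close> gives
  \<open>\<bar>x\<bar> < real (Suc n)\<close> for every \<open>n\<close>.\<close>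

lemma Digamma_reflected_sums_zeta:
  fixes x :: real
  assumes "\<bar>x\<bar> < 1"
  shows "(\<lambda>k. 2 * riemann_zeta (2 * real (Suc k) + 1) * x ^ (2 * Suc k)) sums
    (- 2 * euler_mascheroni - Digamma (1 + x) - Digamma (1 - x))"
proof (rule sums_swap_nonneg)
  show "0 \<le> 2 * x ^ (2 * Suc k) / real (Suc n) ^ (2 * Suc k + 1)" for n k
    by (intro divide_nonneg_nonneg mult_nonneg_nonneg zero_le_even_power zero_le_power) auto
  show "(\<lambda>k. 2 * x ^ (2 * Suc k) / real (Suc n) ^ (2 * Suc k + 1)) sums
      (1 / (real (Suc n) - x) + 1 / (real (Suc n) + x) - 2 / real (Suc n))" for n
    using assms by (intro sums_even_powers) simp
  show "(\<lambda>n. 2 * x ^ (2 * Suc k) / real (Suc n) ^ (2 * Suc k + 1)) sums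
      (2 * riemann_zeta (2 * real (Suc k) + 1) * x ^ (2 * Suc k))" for k
  proof -
    have "real (Suc n) powr - (2 * real (Suc k) + 1) = 1 / real (Suc n) ^ (2 * Suc k + 1)" for n
    proof -
      have "real (Suc n) powr - (2 * real (Suc k) + 1) = real (Suc n) powr - real (2 * Suc k + 1)"
        by simp
      also have "\<dots> = 1 / real (Suc n) ^ (2 * Suc k + 1)"
        by (simp only: powr_minus powr_realpow of_nat_0_less_iff zero_less_Suc inverse_eq_divide)
      finally show ?thesis .
    qed
    with sums_mult[OF riemann_zeta_sums[of "2 * real (Suc k) + 1"], of "2 * x ^ (2 * Suc k)"]
    show ?thesis
      by (simp add: mult_ac del: power_Suc mult_Suc_right)
  qed
  show "(\<lambda>n. 1 / (real (Suc n) - x) + 1 / (real (Suc n) + x) - 2 / real (Suc n)) sums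
      (- 2 * euler_mascheroni - Digamma (1 + x) - Digamma (1 - x))"
  proof -
    \<comment> \<open>The term \<open>2 / real (Suc n)\<close> is shared equally between the series
      at \<open>x\<close> and at \<open>- x\<close>.\<close>
    have "(\<lambda>n. - ((1 / real (Suc n) - 1 / (real (Suc n) + x)) + (1 / real (Suc n) - 1 / (real (Suc n) + - x))))
        sums - ((Digamma (1 + x) + euler_mascheroni) + (Digamma (1 + - x) + euler_mascheroni))"
      using assms by (intro sums_minus sums_add Digamma_plus1_sums) auto
    also have "- ((Digamma (1 + x) + euler_mascheroni) + (Digamma (1 + - x) + euler_mascheroni)) =
        - 2 * euler_mascheroni - Digamma (1 + x) - Digamma (1 - x)"
      by simp
    finally show ?thesis
      by (rule sums_cong[THEN iffD1, rotated]) simp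
  qed
qed

theorem theorem2p2:
  fixes x :: real
  assumes "0 < x" and "x \<le> 1 / 2"
  shows "summable (\<lambda>k. 2 * riemann_zeta (2 * real (Suc k) + 1) * x ^ (2 * Suc k)) \<and>
    ramanujan_R x = 1 / x + (\<Sum>k. 2 * riemann_zeta (2 * real (Suc k) + 1) * x ^ (2 * Suc k))"
proof -
  \<comment> \<open>The recurrence separates off the pole at 0, which is the term
    \<open>1 / x\<close> of the expansion.\<close>
  have "Digamma (1 + x) = Digamma x + 1 / x"
    using assms Digamma_plus1[of x] by (simp add: add.commute)
  then show ?thesis
    using Digamma_reflected_sums_zeta[of x] assms unfolding sums_iff ramanujan_R_def by auto
qed

end
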